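(* Let $m>0$ and $\xi\in\mathbb R^d$ with $\xi\neq0$, and suppose $\hat w=1$ (so that $w*$ is the identity). Consider the matrix of Fourier multipliers on $\mathbb R^d$ $$A=\begin{pmatrix}-2\xi\cdot\nabla&-\Delta&0&0\\\Delta-mw*&-2\xi\cdot\nabla&-mw*&0\\0&0&2\xi\cdot\nabla&-\Delta\\-mw*&0&\Delta-mw*&2\xi\cdot\nabla\end{pmatrix}.$$ Then the symbol of $A$ possesses positive and negative eigenvalues in the vicinity of the frequency $k_0=\xi\sqrt{4-\min(2,m/|\xi|^2)}$; that is, there is a neighbourhood of $k_0$ in $\mathbb R^d$ such that for every $k$ in it, the $4\times4$ matrix $m_A(k)$ has a (real) positive eigenvalue and a (real) negative eigenvalue.
   Context: The symbol $m_A(k)$, $k\in\mathbb R^d$, is the $4\times4$ complex matrix obtained by replacing $\nabla$ by $ik$, $\Delta$ by $-|k|^2$ and $w*$ by $\hat w(k)=1$ in $A$, i.e. $$m_A(k)=\begin{pmatrix}-2i\xi\cdot k&|k|^2&0&0\\-|k|^2-m&-2i\xi\cdot k&-m&0\\0&0&2i\xi\cdot k&|k|^2\\-m&0&-|k|^2-m&2i\xi\cdot k\end{pmatrix}.$$ Origin of $A$: it is the generator of the linearised dynamics of $i\partial_tX=-\Delta X+(w*\mathbb E(|X|^2))X$ around the solution $\sqrt m\,e^{-i(|\xi|^2+m)t}(g_1(\omega)e^{i\xi\cdot x}+g_2(\omega)e^{-i\xi\cdot x})$, where $\mathbb E|g_1|^2=\mathbb E|g_2|^2=\frac12$ and $\mathbb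 E(\overline{g_1}g_2)=0$; $A$ acts on $(\mathrm{Re}\,\varepsilon_1,\mathrm{Im}\,\varepsilon_1,\mathrm{Re}\,\varepsilon_2,\mathrm{Im}\,\varepsilon_2)$, where $\varepsilon_1,\varepsilon_2$ are the perturbations of the amplitudes of the two waves. *)

theory Defs
  imports "HOL-Analysis.Analysis" "Jordan_Normal_Form.Char_Poly"
begin

text \<open>A Fourier multiplier on \<open>\<real>\<^sup>d\<close> is represented by its symbol \<open>\<sigma>\<close>: it maps
  \<open>exp (i k \<cdot> x)\<close> to \<open>\<sigma> k * exp (i k \<cdot> x)\<close>.\<close>

type_synonym 'd multiplier = "real ^ 'd \<Rightarrow> complex"

text \<open>The directional derivative \<open>v \<cdot> \<nabla>\<close>, obtained by replacing \<open>\<nabla>\<close> by \<open>i k\<close>.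
  The function \<open>inner\<close> is written in prefix form because the matrix library declares
  the same infix for its own scalar product.\<close>

definition dir_nabla :: "real ^ 'd \<Rightarrow> ('d::finite) multiplier" where
  "dir_nabla v = (\<lambda>k. \<i> * complex_of_real (inner v k))"

definition laplacian :: "('d::finite) multiplier" where
  "laplacian = (\<lambda>k. - complex_of_real ((norm k)\<^sup>2))"

text \<open>The operator \<open>A\<close>; convolution with \<open>w\<close> is the multiplier \<open>w_hat\<close>.\<close>

definition lin_op ::
    "real \<Rightarrow> real ^ 'd \<Rightarrow> 'd multiplier \<Rightarrow> ('d::finite) multiplier mat" where
  "lin_op m \<xi> w_hat = mat_of_rows_list 4
    [[\<lambda>k. - 2 * dir_nabla \<xi> k, \<lambda>k. - laplacian k, \<lambda>k. 0, \<lambda>k. 0],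
     [\<lambda>k. laplacian k - of_real m * w_hat k, \<lambda>k. - 2 * dir_nabla \<xi> k,
        \<lambda>k. - of_real m * w_hat k, \<lambda>k. 0],
     [\<lambda>k. 0, \<lambda>k. 0, \<lambda>k. 2 * dir_nabla \<xi> k, \<lambda>k. - laplacian k],
     [\<lambda>k. - of_real m * w_hat k, \<lambda>k. 0,
        \<lambda>k. laplacian k - of_real m * w_hat k, \<lambda>k. 2 * dir_nabla \<xi> k]]"

definition symbol :: "('d::finite) multiplier mat \<Rightarrow> real ^ 'd \<Rightarrow> complex mat" where
  "symbol A k = map_mat (\<lambda>\<sigma>. \<sigma> k) A"

lemma symbol_lin_op:
  fixes m :: real and \<xi> k :: "real ^ 'd"
  defines "a \<equiv> 2 * \<i> * complex_of_real (inner \<xi> k)"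
    and "K \<equiv> complex_of_real ((norm k)\<^sup>2)"
    and "\<mu> \<equiv> complex_of_real m"
  assumes "w_hat k = 1"
  shows "symbol (lin_op m \<xi> w_hat) k = mat_of_rows_list 4
    [[- a, K, 0, 0],
     [- K - \<mu>, - a, - \<mu>, 0],
     [0, 0, a, K],
     [- \<mu>, 0, - K - \<mu>, a]]"
  unfolding symbol_def lin_op_def mat_of_rows_list_def
  by (rule eq_matI)
     (auto simp: assms dir_nabla_def laplacian_def less_Suc_eq numeral_eq_Suc)

end

theory Submission
  imports Defs
begin

text \<open>Put \<open>s = \<xi> \<cdot> k\<close>, \<open>K = |k|\<^sup>2\<close> and \<open>P = K\<^sup>2 + m K\<close>. Eliminating the second and fourth
  coordinates of an eigenvector leaves a two by two system, so \<open>\<lambda>\<close> is an eigenvalue once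
  \<open>((\<lambda> + 2 \<i> s)\<^sup>2 + P) ((\<lambda> - 2 \<i> s)\<^sup>2 + P) = (m K)\<^sup>2\<close>. This is a monic quadratic equation in
  \<open>\<lambda>\<^sup>2\<close> with constant term \<open>(4 s\<^sup>2 - P)\<^sup>2 - (m K)\<^sup>2\<close>, which is negative exactly when
  \<open>0 < 4 s\<^sup>2 - K\<^sup>2 < 2 m K\<close>. Under this open condition the quadratic has a positive root \<open>x\<close>,
  and \<open>\<lambda> = \<plusminus> sqrt x\<close> are real eigenvalues. At \<open>k = c \<xi>\<close> the condition reads
  \<open>0 < |\<xi>|\<^sup>2 (4 - c\<^sup>2) < 2 m\<close>, which holds for \<open>c\<^sup>2 = 4 - min 2 (m / |\<xi>|\<^sup>2)\<close>.\<close>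

text \<open>A negative constant term pushes the discriminant above \<open>b\<^sup>2\<close>, so the
  larger root is positive.\<close>

lemma monic_quadratic_pos_root:
  fixes b c :: real
  assumes "c < 0"
  obtains x where "x > 0" and "x\<^sup>2 + b * x + c = 0"
proof
  let ?D = "sqrt (b\<^sup>2 - 4 * c)"
  have "\<bar>b\<bar> < ?D"
    using assms by (intro real_less_rsqrt) simp
  then show "(?D - b) / 2 > 0"
    by simp
  have "?D\<^sup>2 = b\<^sup>2 - 4 * c"
    using assms zero_le_power2[of b] by (intro real_sqrt_pow2) linarith
  then show "((?D - b) / 2)\<^sup>2 + b * ((?D - b) / 2) + c = 0"
    by (simp add: power2_eq_square field_simps)
qed

lemma eigenvalue_block_matrix:
  fixes a K \<mu> l :: complex
  assumes "K \<noteq> 0" and "\<mu> \<noteq> 0"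
    and char_eq: "((l + a)\<^sup>2 + K\<^sup>2 + \<mu> * K) * ((l - a)\<^sup>2 + K\<^sup>2 + \<mu> * K) = (\<mu> * K)\<^sup>2"
  shows "eigenvalue (mat_of_rows_list 4
    [[- a, K, 0, 0],
     [- K - \<mu>, - a, - \<mu>, 0],
     [0, 0, a, K],
     [- \<mu>, 0, - K - \<mu>, a]]) l" (is "eigenvalue ?A l")
proof -
  define q where "q = (l + a)\<^sup>2 + K\<^sup>2 + \<mu> * K"
  \<comment> \<open>Rows 1 and 3 determine the second and fourth coordinates from the first and
    third. With first coordinate \<open>\<mu> * K\<close>, row 2 forces the third to be
    \<open>- q\<close>. Row 4 then becomes \<open>char_eq\<close>.\<close>
  define v where "v = vec_of_list [\<mu> * K, \<mu> * (l + a), - q, - (l - a) * q / K]"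
  have dims: "dim_row ?A = 4" "dim_col ?A = 4" "dim_vec v = 4"
    by (simp_all add: v_def mat_of_rows_list_def)
  have "v $ 0 \<noteq> 0"
    using assms by (simp add: v_def)
  then have "v \<noteq> 0\<^sub>v 4"
    by auto
  have row2: "(- K - \<mu>) * (\<mu> * K) + - a * (\<mu> * (l + a)) + \<mu> * q = l * (\<mu> * (l + a))"
    by (simp add: q_def power2_eq_square algebra_simps)
  have "q * ((l - a)\<^sup>2 + K\<^sup>2 + \<mu> * K) = (\<mu> * K)\<^sup>2"
    using char_eq by (simp add: q_def)
  then have row4: "- \<mu> * (\<mu> * K) + (K + \<mu>) * q + a * (- (l - a) * q / K) = l * (- (l - a) * q / K)"
    using \<open>K \<noteq> 0\<close> by (simp add: field_simps power2_eq_square)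
  have "?A *\<^sub>v v = l \<cdot>\<^sub>v v"
  proof (rule eq_vecI)
    fix i
    assume "i < dim_vec (l \<cdot>\<^sub>v v)"
    then have "i \<in> {0, 1, 2, 3}"
      using dims by auto
    then show "(?A *\<^sub>v v) $ i = (l \<cdot>\<^sub>v v) $ i"
      using row2 row4 \<open>K \<noteq> 0\<close>
      by (auto simp: v_def mat_of_rows_list_def scalar_prod_def sum.atLeast0_lessThan_Suc
          numeral_eq_Suc algebra_simps diff_divide_distrib)
  qed (simp add: dims)
  with \<open>v \<noteq> 0\<^sub>v 4\<close> show ?thesis
    unfolding eigenvalue_def eigenvector_def
    using dims by (metis carrier_vec_dim_vec)
qed

lemma symbol_real_eigenvalues:
  fixes \<xi> k :: "real ^ 'd"
  assumes "m > 0" and "w_hat k = 1"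
    and lower: "0 < 4 * (inner \<xi> k)\<^sup>2 - ((norm k)\<^sup>2)\<^sup>2"
    and upper: "4 * (inner \<xi> k)\<^sup>2 - ((norm k)\<^sup>2)\<^sup>2 < 2 * m * (norm k)\<^sup>2"
  obtains r where "r > 0"
    and "eigenvalue (symbol (lin_op m \<xi> w_hat) k) (complex_of_real r)"
    and "eigenvalue (symbol (lin_op m \<xi> w_hat) k) (complex_of_real (- r))"
proof -
  define s where "s = inner \<xi> k"
  define K where "K = (norm k)\<^sup>2"
  define P where "P = K\<^sup>2 + m * K"
  have K: "K \<noteq> 0"
    using lower upper by (auto simp: K_def)
  \<comment> \<open>Subtracting \<open>m * K\<close> centres the interval from 0 to
    \<open>2 * m * K\<close> at 0.\<close>
  have "\<bar>4 * s\<^sup>2 - P\<bar> < \<bar>m * K\<bar>"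
    using lower upper unfolding s_def[symmetric] K_def[symmetric] P_def by linarith
  then have "(4 * s\<^sup>2 - P)\<^sup>2 - (m * K)\<^sup>2 < 0"
    by (metis abs_le_square_iff diff_less_0_iff_less not_less)
  then obtain x where x: "x > 0"
    "x\<^sup>2 + (8 * s\<^sup>2 + 2 * P) * x + ((4 * s\<^sup>2 - P)\<^sup>2 - (m * K)\<^sup>2) = 0"
    by (rule monic_quadratic_pos_root)
  \<comment> \<open>Only the square of \<open>l\<close> is prescribed, so both signs of
    \<open>sqrt x\<close> are covered at once.\<close>
  have ev: "eigenvalue (symbol (lin_op m \<xi> w_hat) k) (complex_of_real l)" if "l\<^sup>2 = x" for l
    unfolding symbol_lin_op[of w_hat k, OF \<open>w_hat k = 1\<close>]
  proof (rule eigenvalue_block_matrix, goal_cases)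
    case 3
    define a where "a = 2 * \<i> * complex_of_real s"
    have a: "a\<^sup>2 = - complex_of_real (4 * s\<^sup>2)"
      by (simp add: a_def power_mult_distrib)
    \<comment> \<open>The product is even in \<open>l\<close> and in \<open>a\<close>, and
      \<open>a\<^sup>2\<close> is real, so the complex equation reduces to the real quadratic for
      \<open>x\<close>.\<close>
    have "((l + a)\<^sup>2 + complex_of_real P) * ((l - a)\<^sup>2 + complex_of_real P)
        = ((complex_of_real l)\<^sup>2 - a\<^sup>2)\<^sup>2 + 2 * complex_of_real P * ((complex_of_real l)\<^sup>2 + a\<^sup>2)
          + (complex_of_real P)\<^sup>2"
      by (simp add: power2_eq_square algebra_simps)
    also have "\<dots> = complex_of_real ((x + 4 * s\<^sup>2)\<^sup>2 + 2 * P * (x - 4 * s\<^sup>2) + P\<^sup>2)"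
      by (simp add: a flip: \<open>l\<^sup>2 = x\<close>)
    also have "(x + 4 * s\<^sup>2)\<^sup>2 + 2 * P * (x - 4 * s\<^sup>2) + P\<^sup>2 = (m * K)\<^sup>2"
      using x(2) by (simp add: power2_eq_square algebra_simps)
    finally show ?case
      by (simp add: a_def s_def K_def P_def add.assoc)
  qed (use K \<open>m > 0\<close> in \<open>simp_all add: K_def\<close>)
  show thesis
    using x(1) by (intro that[of "sqrt x"] ev) simp_all
qed

theorem lemma9p1:
  fixes m :: real and \<xi> k\<^sub>0 :: "real ^ 'd" and w_hat :: "'d multiplier"
  assumes "m > 0" and "\<xi> \<noteq> 0"
    and "\<forall>k. w_hat k = 1"
    and "k\<^sub>0 = sqrt (4 - min 2 (m / (norm \<xi>)\<^sup>2)) *\<^sub>R \<xi>"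
  shows "\<exists>U. open U \<and> k\<^sub>0 \<in> U \<and>
    (\<forall>k\<in>U. (\<exists>r::real. r > 0 \<and> eigenvalue (symbol (lin_op m \<xi> w_hat) k) (complex_of_real r)) \<and>
            (\<exists>r::real. r < 0 \<and> eigenvalue (symbol (lin_op m \<xi> w_hat) k) (complex_of_real r)))"
proof -
  define f where "f = (\<lambda>k. 4 * (inner \<xi> k)\<^sup>2 - ((norm k)\<^sup>2)\<^sup>2)"
  define U where "U = {k. 0 < f k} \<inter> {k. f k < 2 * m * (norm k)\<^sup>2}"
  have "open U"
    unfolding U_def f_def by (intro open_Int open_Collect_less continuous_intros)
  moreover have "k\<^sub>0 \<in> U"
  proof -
    define n where "n = (norm \<xi>)\<^sup>2"
    define t where "t = min 2 (m / n)"
    define c where "c = sqrt (4 - t)"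
    have n: "n > 0"
      using \<open>\<xi> \<noteq> 0\<close> by (simp add: n_def)
    \<comment> \<open>The cap 2 keeps \<open>4 - t\<close> positive, and the cap
      \<open>m / n\<close> gives \<open>n * t \<le> m\<close>, strictly below the bound
      \<open>2 * m\<close> needed for membership in \<open>U\<close>.\<close>
    have t: "0 < t" "t \<le> 2" "n * t \<le> m"
      using n \<open>m > 0\<close> by (auto simp: t_def min_def field_simps)
    have c2: "c\<^sup>2 = 4 - t"
      using t by (simp add: c_def)
    have k0: "k\<^sub>0 = c *\<^sub>R \<xi>"
      using assms(4) by (simp add: c_def t_def n_def)
    have s: "inner \<xi> k\<^sub>0 = c * n" and K: "(norm k\<^sub>0)\<^sup>2 = c\<^sup>2 * n"
      by (simp_all add: k0 n_def power_mult_distrib power2_norm_eq_inner)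
    have f: "f k\<^sub>0 = (c\<^sup>2 * n) * (n * t)"
    proof -
      have "f k\<^sub>0 = c\<^sup>2 * n\<^sup>2 * (4 - c\<^sup>2)"
        unfolding f_def s K by (simp add: power2_eq_square algebra_simps)
      also have "\<dots> = c\<^sup>2 * n\<^sup>2 * t"
        by (simp add: c2)
      finally show ?thesis
        by (simp add: power2_eq_square)
    qed
    have pos: "c\<^sup>2 * n > 0"
      using n t by (simp add: c2)
    have "f k\<^sub>0 > 0"
      using pos n t by (simp add: f)
    moreover have "f k\<^sub>0 < 2 * m * (norm k\<^sub>0)\<^sup>2"
    proof -
      have "(c\<^sup>2 * n) * (n * t) < (c\<^sup>2 * n) * (2 * m)"
        using pos t \<open>m > 0\<close> by (intro mult_strict_left_mono) auto
      then show ?thesis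
        by (simp add: f K mult.commute)
    qed
    ultimately show ?thesis
      by (simp add: U_def)
  qed
  moreover have "(\<exists>r::real. r > 0 \<and> eigenvalue (symbol (lin_op m \<xi> w_hat) k) (complex_of_real r)) \<and>
            (\<exists>r::real. r < 0 \<and> eigenvalue (symbol (lin_op m \<xi> w_hat) k) (complex_of_real r))"
    if "k \<in> U" for k
  proof -
    obtain r where "r > 0"
      and "eigenvalue (symbol (lin_op m \<xi> w_hat) k) (complex_of_real r)"
      and "eigenvalue (symbol (lin_op m \<xi> w_hat) k) (complex_of_real (- r))"
      using symbol_real_eigenvalues[of m w_hat k \<xi>] assms(1,3) \<open>k \<in> U\<close>
      by (auto simp: U_def f_def)
    then show ?thesis
      by (meson neg_less_0_iff_less)
  qed
  ultimately show ?thesis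
    by blast
qed

end
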